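(* Let $(i,j)\ne(k,\ell)$ be elements of $\{1,2,3\}^2$, so that $R_{ij}$ and $R_{k\ell}$ are two distinct cubic local ratios, and let $a,b\ge0$ be real. Then exactly one of the following cases occurs (with the convention $0^0=1$). (i) If the two ratios lie in the same row ($i=k$), then $$\sup_{f\in\mathcal L_{3,3}^+}R_{ij}(f)^aR_{k\ell}(f)^b=2^{a+b}\frac{a^ab^b}{(a+b)^{a+b}}.$$ (ii) If they form a transposed off-diagonal pair, i.e. $i\ne j$ and $(k,\ell)=(j,i)$, then $$\sup_{f\in\mathcal L_{3,3}^+}R_{ij}(f)^aR_{ji}(f)^b=2^{|a-b|}.$$ (iii) In every other case, $$\sup_{f\in\mathcal L_{3,3}^+}R_{ij}(f)^aR_{k\ell}(f)^b=2^{a+b}.$$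
   Context: $\Delta_3^3=\{\alpha\in\mathbb Z_{\ge0}^3:\alpha_1+\alpha_2+\alpha_3=3\}$, $e_1,e_2,e_3$ is the standard basis of $\mathbb R^3$. $\mathcal L_{3,3}^+$ is the set of full-support Lorentzian cubics in three variables: $f=\sum_{\alpha\in\Delta_3^3}c_\alpha x_1^{\alpha_1}x_2^{\alpha_2}x_3^{\alpha_3}/(\alpha_1!\alpha_2!\alpha_3!)$ with all $c_\alpha>0$ such that for each $i\in\{1,2,3\}$ the symmetric matrix $(c_{e_i+e_j+e_k})_{1\le j,k\le3}$ has at most one positive eigenvalue. The nine cubic local ratios are, writing $c_{abc}=c_{(a,b,c)}$: $R_{11}=\frac{c_{111}c_{300}}{c_{210}c_{201}}$, $R_{12}=\frac{c_{201}c_{120}}{c_{210}c_{111}}$, $R_{13}=\frac{c_{210}c_{102}}{c_{201}c_{111}}$, $R_{21}=\frac{c_{021}c_{210}}{c_{120}c_{111}}$, $R_{22}=\frac{c_{111}c_{030}}{c_{120}c_{021}}$, $R_{23}=\frac{c_{120}c_{012}}{c_{111}c_{021}}$, $R_{31}=\frac{c_{012}c_{201}}{c_{111}c_{102}}$, $R_{32}=\frac{c_{102}c_{021}}{c_{111}c_{012}}$, $R_{33}=\frac{c_{111}c_{003}}{c_{102}c_{012}}$. The $i$th row is $(R_{i1},R_{i2},R_{i3})$. *)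

theory Defs
  imports
    "HOL-Library.Poly_Mapping"
    "HOL-Library.Product_Plus"
    "HOL-Library.Extended_Real"
    "Jordan_Normal_Form.Char_Poly"
begin

text \<open>
  Real polynomials in three variables form the monoid algebra of the additive monoid of exponents
  \<open>(a, b, c)\<close>, the monomial \<open>x\<^sub>1 ^ a * x\<^sub>2 ^ b * x\<^sub>3 ^ c\<close> being \<open>Poly_Mapping.single (a, b, c) 1\<close>.
  All indices below (variables, rows and columns of the table of ratios) are 1-based.
\<close>

type_synonym exponent = "nat \<times> nat \<times> nat"

type_synonym polynomial3 = "exponent \<Rightarrow>\<^sub>0 real"

definition Delta33 :: "exponent set" where
  "Delta33 = {(a, b, c). a + b + c = 3}"

definition exponent_fact :: "exponent \<Rightarrow> real" where
  "exponent_fact = (\<lambda>(a, b, c). fact a * fact b * fact c)"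

definition ncoeff :: "polynomial3 \<Rightarrow> exponent \<Rightarrow> real" where
  "ncoeff f \<alpha> = exponent_fact \<alpha> * Poly_Mapping.lookup f \<alpha>"

definition unit_exponent :: "nat \<Rightarrow> exponent" where
  "unit_exponent i = (of_bool (i = 1), of_bool (i = 2), of_bool (i = 3))"

text \<open>Matrix entries are 0-based in the matrix library, hence the two successors.\<close>

definition coeff_matrix :: "polynomial3 \<Rightarrow> nat \<Rightarrow> real mat" where
  "coeff_matrix f i =
     mat 3 3 (\<lambda>(j, k). ncoeff f (unit_exponent i + unit_exponent (Suc j) + unit_exponent (Suc k)))"

text \<open>Eigenvalues are counted with multiplicity, as roots of the characteristic polynomial.\<close>

definition at_most_one_positive_eigenvalue :: "real mat \<Rightarrow> bool" where
  "at_most_one_positive_eigenvalue A \<longleftrightarrow> size {#t \<in># proots (char_poly A). 0 < t#} \<le> 1"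

definition full_support_lorentzian_cubics :: "polynomial3 set" where
  "full_support_lorentzian_cubics =
     {f. f = (\<Sum>\<alpha>\<in>Delta33. Poly_Mapping.single \<alpha> (ncoeff f \<alpha> / exponent_fact \<alpha>)) \<and>
         (\<forall>\<alpha>\<in>Delta33. 0 < ncoeff f \<alpha>) \<and>
         (\<forall>i\<in>{1..3}. at_most_one_positive_eigenvalue (coeff_matrix f i))}"

definition local_ratio :: "nat \<Rightarrow> nat \<Rightarrow> polynomial3 \<Rightarrow> real" where
  "local_ratio i j f =
     (let c = (\<lambda>a1 a2 a3. ncoeff f (a1, a2, a3)) in
      [[c 1 1 1 * c 3 0 0 / (c 2 1 0 * c 2 0 1),
        c 2 0 1 * c 1 2 0 / (c 2 1 0 * c 1 1 1),
        c 2 1 0 * c 1 0 2 / (c 2 0 1 * c 1 1 1)],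
       [c 0 2 1 * c 2 1 0 / (c 1 2 0 * c 1 1 1),
        c 1 1 1 * c 0 3 0 / (c 1 2 0 * c 0 2 1),
        c 1 2 0 * c 0 1 2 / (c 1 1 1 * c 0 2 1)],
       [c 0 1 2 * c 2 0 1 / (c 1 1 1 * c 1 0 2),
        c 1 0 2 * c 0 2 1 / (c 1 1 1 * c 0 1 2),
        c 1 1 1 * c 0 0 3 / (c 1 0 2 * c 0 1 2)]] ! (i - 1) ! (j - 1))"

text \<open>
  Real powers with \<open>0\<^sup>0 = 1\<close>; the library has \<open>0 powr 0 = 0\<close>.
\<close>

definition rpow :: "real \<Rightarrow> real \<Rightarrow> real" where
  "rpow x y = (if y = 0 then 1 else x powr y)"

text \<open>
  The supremum is taken in the extended reals, so that equality with a real number includes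
  boundedness.
\<close>

definition sup_ratio_powers :: "nat \<times> nat \<Rightarrow> nat \<times> nat \<Rightarrow> real \<Rightarrow> real \<Rightarrow> ereal" where
  "sup_ratio_powers = (\<lambda>(i, j) (k, l) a b.
     (SUP f\<in>full_support_lorentzian_cubics.
        ereal (rpow (local_ratio i j f) a * rpow (local_ratio k l f) b)))"

definition same_row :: "nat \<times> nat \<Rightarrow> nat \<times> nat \<Rightarrow> bool" where
  "same_row = (\<lambda>(i, j) (k, l). i = k)"

definition transposed_off_diagonal :: "nat \<times> nat \<Rightarrow> nat \<times> nat \<Rightarrow> bool" where
  "transposed_off_diagonal = (\<lambda>(i, j) (k, l). i \<noteq> j \<and> (k, l) = (j, i))"

definition other_pair :: "nat \<times> nat \<Rightarrow> nat \<times> nat \<Rightarrow> bool" where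
  "other_pair p q \<longleftrightarrow> \<not> same_row p q \<and> \<not> transposed_off_diagonal p q"

definition exactly_one :: "bool \<Rightarrow> bool \<Rightarrow> bool \<Rightarrow> bool" where
  "exactly_one P Q R \<longleftrightarrow> (P \<or> Q \<or> R) \<and> \<not> (P \<and> Q) \<and> \<not> (P \<and> R) \<and> \<not> (Q \<and> R)"

end

theory Submission
  imports Defs
begin

text \<open>
  Scaling the rows and columns of the \<open>i\<close>th coefficient matrix by the same positive numbers preserves its
  signature and can make all off-diagonal entries \<open>1\<close>; its diagonal then consists of the three ratios
  \<open>u, v, w\<close> of row \<open>i\<close>. Having at most one positive eigenvalue becomes \<open>u v, u w, v w \<le> 1\<close> together with \<open>u + v + w \<le> 2 + u v w\<close>
  (\<open>row_condition_iff\<close>). This gives all upper bounds: two ratios in a row have sum at most \<open>2\<close>, so each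
  ratio is at most \<open>2\<close> and the weighted arithmetic-geometric mean inequality bounds a product of powers
  within a row. The ratios also satisfy identities such as \<open>R\<^sub>1\<^sub>2 R\<^sub>2\<^sub>1 = R\<^sub>3\<^sub>1 R\<^sub>3\<^sub>2\<close>, whose right-hand side
  comes from a single row, so a transposed pair has product at most \<open>1\<close>.

  Conversely, every positive table that satisfies these identities and whose row sums are at most \<open>2\<close>
  comes from a Lorentzian cubic (\<open>lorentzian_of_ratio_table\<close>). Sharpness is then a matter of exhibiting
  tables. Up to the free diagonal, the identities are solved by \<open>R\<^sub>i\<^sub>j = m\<^sub>j \<lambda>\<close> for \<open>(i, j)\<close> in the
  cyclic triple \<open>(1,2), (2,3), (3,1)\<close> and \<open>R\<^sub>i\<^sub>j = m\<^sub>j / \<lambda>\<close> for the opposite triple. Equal rows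
  (\<open>\<lambda> = 1\<close>) serve for two ratios in a common row or a common column; letting one cyclic triple vanish
  serves for the remaining pairs of the third case; and a transposed pair can approach the values
  \<open>2\<close> and \<open>1/2\<close>. The tables used have zero entries, whereas all ratios are positive; what matters is
  that the ratios of suitable cubics dominate every slightly shrunk copy of the table, which is what
  \<open>approached_table\<close> records.
\<close>

section \<open>Positive eigenvalues of symmetric matrices of order three\<close>

lemma det_mat_3:
  fixes g :: "nat \<times> nat \<Rightarrow> 'a :: comm_ring_1"
  shows "det (mat 3 3 g) =
    g (0,0) * (g (1,1) * g (2,2) - g (1,2) * g (2,1))
    - g (0,1) * (g (1,0) * g (2,2) - g (1,2) * g (2,0))
    + g (0,2) * (g (1,0) * g (2,1) - g (1,1) * g (2,0))"
proof -
  have two: "det (mat 2 2 h) = h (0,0) * h (1,1) - h (0,1) * h (1,0)" for h :: "nat \<times> nat \<Rightarrow> 'a"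
  proof -
    have "det (mat 2 2 h) = (\<Sum>j<2. mat 2 2 h $$ (0,j) * cofactor (mat 2 2 h) 0 j)"
      by (rule laplace_expansion_row) auto
    also have "\<dots> = h (0,0) * h (1,1) - h (0,1) * h (1,0)"
      by (simp add: numeral_2_eq_2 cofactor_def mat_delete_def det_single)
    finally show ?thesis .
  qed
  have del: "mat_delete (mat 3 3 g) 0 j =
      mat 2 2 (\<lambda>(r, s). g (Suc r, if s < j then s else Suc s))" for j
    by (rule eq_matI) (auto simp: mat_delete_def)
  have "det (mat 3 3 g) = (\<Sum>j<3. mat 3 3 g $$ (0,j) * cofactor (mat 3 3 g) 0 j)"
    by (rule laplace_expansion_row) auto
  also have "\<dots> = g (0,0) * det (mat 2 2 (\<lambda>(r, s). g (Suc r, if s < 0 then s else Suc s)))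
      - g (0,1) * det (mat 2 2 (\<lambda>(r, s). g (Suc r, if s < 1 then s else Suc s)))
      + g (0,2) * det (mat 2 2 (\<lambda>(r, s). g (Suc r, if s < 2 then s else Suc s)))"
    by (simp add: eval_nat_numeral cofactor_def del[unfolded eval_nat_numeral, simplified])
  finally show ?thesis
    unfolding two by (simp add: numeral_2_eq_2)
qed

text \<open>
  The characteristic polynomial of the symmetric matrix with diagonal \<open>p, q, r\<close> and off-diagonal
  entries \<open>x, y, z\<close> in the positions \<open>(1,2), (1,3), (2,3)\<close>: its coefficients are, up to sign, the
  determinant, the sum of the principal \<open>2 \<times> 2\<close> minors and the trace.
\<close>

definition sym_char_poly :: "real \<Rightarrow> real \<Rightarrow> real \<Rightarrow> real \<Rightarrow> real \<Rightarrow> real \<Rightarrow> real poly" where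
  "sym_char_poly p q r x y z =
    [: - (p*q*r + 2*x*y*z - p*z^2 - q*y^2 - r*x^2),
       p*q + p*r + q*r - x^2 - y^2 - z^2, - (p + q + r), 1 :]"

lemma char_poly_symmetric_3:
  fixes g :: "nat \<times> nat \<Rightarrow> real"
  assumes "g (0,0) = p" "g (1,1) = q" "g (2,2) = r"
    and "g (0,1) = x" "g (1,0) = x" "g (0,2) = y" "g (2,0) = y" "g (1,2) = z" "g (2,1) = z"
  shows "char_poly (mat 3 3 g) =
    sym_char_poly p q r x y z"
proof -
  have "char_poly_matrix (mat 3 3 g) = mat 3 3 (\<lambda>(i, j). [: - g (i, j), of_bool (i = j) :])"
    by (rule eq_matI) (auto simp: char_poly_matrix_def)
  then show ?thesis
    by (simp add: sym_char_poly_def char_poly_def det_mat_3 assms[unfolded One_nat_def] algebra_simps power2_eq_square)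
qed

text \<open>
  Splitting off one linear factor removes exactly one element of the multiset of roots, so a
  second positive root, distinct or repeated, is a second linear factor. In this form multiplicity
  is handled by divisibility alone.
\<close>

lemma at_most_one_positive_proot_iff:
  fixes P :: "real poly"
  assumes "P \<noteq> 0"
  shows "size {#t \<in># proots P. 0 < t#} \<le> 1 \<longleftrightarrow>
    (\<forall>\<alpha> \<beta>. 0 < \<alpha> \<longrightarrow> 0 < \<beta> \<longrightarrow> \<not> [:-\<alpha>, 1:] * [:-\<beta>, 1:] dvd P)" (is "?L \<longleftrightarrow> ?R")
proof
  assume L: ?L
  show ?R
  proof (intro allI impI notI)
    fix \<alpha> \<beta> :: real
    assume pos: "0 < \<alpha>" "0 < \<beta>" and "[:-\<alpha>, 1:] * [:-\<beta>, 1:] dvd P"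
    then obtain Q where P: "P = [:-\<alpha>, 1:] * [:-\<beta>, 1:] * Q" by (elim dvdE)
    with assms have nz: "Q \<noteq> 0" "[:-\<alpha>, 1:] \<noteq> 0" "[:-\<beta>, 1:] \<noteq> 0" by auto
    then have "proots P = proots [:-\<alpha>, 1:] + proots [:-\<beta>, 1:] + proots Q"
      unfolding P by (metis mult_eq_0_iff proots_mult)
    then have "proots P = {#\<alpha>#} + {#\<beta>#} + proots Q"
      by simp
    with L pos show False by simp
  qed
next
  assume R: ?R
  show ?L
  proof (rule ccontr)
    assume "\<not> ?L"
    then have "2 \<le> size {#t \<in># proots P. 0 < t#}" by simp
    then obtain n where "size {#t \<in># proots P. 0 < t#} = Suc (Suc n)"
      by (metis add_2_eq_Suc le_Suc_ex)
    moreover from this obtain \<alpha> N where N: "{#t \<in># proots P. 0 < t#} = add_mset \<alpha> N"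
      using size_eq_Suc_imp_eq_union by blast
    ultimately have "size N = Suc n" by simp
    then obtain \<beta> M where "N = add_mset \<beta> M"
      using size_eq_Suc_imp_eq_union by blast
    with N have M: "{#t \<in># proots P. 0 < t#} = add_mset \<alpha> (add_mset \<beta> M)" by simp
    then have "\<alpha> \<in># {#t \<in># proots P. 0 < t#}" "\<beta> \<in># {#t \<in># proots P. 0 < t#}" by auto
    then have pos: "0 < \<alpha>" "0 < \<beta>" and "poly P \<alpha> = 0" using assms by auto
    then obtain Q where P: "P = [:-\<alpha>, 1:] * Q" by (metis poly_eq_0_iff_dvd dvdE)
    with assms have "[:-\<alpha>, 1:] * Q \<noteq> 0" "Q \<noteq> 0" by auto
    then have "proots P = add_mset \<alpha> (proots Q)" unfolding P by (subst proots_mult) auto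
    with M pos have "{#t \<in># proots Q. 0 < t#} = add_mset \<beta> M" by simp
    then have "\<beta> \<in># {#t \<in># proots Q. 0 < t#}" by simp
    then have "poly Q \<beta> = 0" using \<open>Q \<noteq> 0\<close> by auto
    then have "[:-\<beta>, 1:] dvd Q" by (simp add: poly_eq_0_iff_dvd)
    then have "[:-\<alpha>, 1:] * [:-\<beta>, 1:] dvd P" unfolding P by (rule mult_dvd_mono[OF dvd_refl])
    with R pos show False by blast
  qed
qed

lemma exists_root_ge_nonpositive_value:
  fixes P :: "real poly"
  assumes "0 < lead_coeff P" "poly P t \<le> 0"
  obtains c where "t \<le> c" "poly P c = 0"
proof (cases "poly P t = 0")
  case True
  then show ?thesis using that by blast
next
  case False
  obtain n where n: "\<And>x. n \<le> x \<Longrightarrow> lead_coeff P \<le> poly P x"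
    using poly_pinfty_gt_lc[OF assms(1)] by blast
  have "0 < poly P (max n (t + 1))" using n[of "max n (t + 1)"] assms(1) by linarith
  moreover have "poly P t < 0" using False assms(2) by simp
  moreover have "t < max n (t + 1)" by linarith
  ultimately obtain c where "t < c" "poly P c = 0"
    using poly_IVT_pos[of t "max n (t + 1)" P] by blast
  then show ?thesis using that by (meson less_imp_le)
qed

text \<open>
  The polynomial is positive far out, so it has a root \<open>c \<ge> \<mu>\<close>. The quotient by \<open>t - c\<close> must stay
  positive on the positive axis, as otherwise it would contribute a second positive root; hence the
  polynomial has the sign of \<open>t - c\<close> there.
\<close>

lemma negative_left_of_nonpositive_value:
  fixes P :: "real poly"
  assumes "0 < lead_coeff P"
    and simple: "\<And>\<alpha> \<beta>. 0 < \<alpha> \<Longrightarrow> 0 < \<beta> \<Longrightarrow> \<not> [:-\<alpha>, 1:] * [:-\<beta>, 1:] dvd P"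
    and "poly P \<mu> \<le> 0" "0 < t" "t < \<mu>"
  shows "poly P t < 0"
proof -
  obtain c where c: "\<mu> \<le> c" "poly P c = 0"
    by (rule exists_root_ge_nonpositive_value[OF assms(1,3)])
  then obtain Q where P: "P = [:-c, 1:] * Q" by (metis poly_eq_0_iff_dvd dvdE)
  have lead: "0 < lead_coeff Q" using assms(1) unfolding P lead_coeff_mult by simp
  have "0 < poly Q t"
  proof (rule ccontr)
    assume "\<not> 0 < poly Q t"
    then have "poly Q t \<le> 0" by simp
    then obtain d where d: "t \<le> d" "poly Q d = 0"
      by (rule exists_root_ge_nonpositive_value[OF lead])
    then have "[:-c, 1:] * [:-d, 1:] dvd P"
      unfolding P by (intro mult_dvd_mono dvd_refl) (simp add: poly_eq_0_iff_dvd)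
    with simple[of c d] c d assms(4,5) show False by linarith
  qed
  then show ?thesis using c assms(5) by (simp add: P mult_neg_pos)
qed

lemma nonpositive_at_zero_of_nonpositive_value:
  fixes P :: "real poly"
  assumes "0 < lead_coeff P"
    and simple: "\<And>\<alpha> \<beta>. 0 < \<alpha> \<Longrightarrow> 0 < \<beta> \<Longrightarrow> \<not> [:-\<alpha>, 1:] * [:-\<beta>, 1:] dvd P"
    and "poly P \<mu> \<le> 0" "0 < \<mu>"
  shows "poly P 0 \<le> 0"
proof (rule ccontr)
  note neg = negative_left_of_nonpositive_value[OF assms(1) simple assms(3)]
  assume "\<not> poly P 0 \<le> 0"
  moreover have "poly P (\<mu> / 2) < 0" using neg[of "\<mu> / 2"] assms(4) by simp
  ultimately obtain s where "0 < s" "s < \<mu> / 2" "poly P s = 0"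
    using poly_IVT_neg[of 0 "\<mu> / 2" P] assms(4) by auto
  with neg[of s] assms(4) show False by simp
qed

text \<open>
  Cauchy interlacing for the leading \<open>2 \<times> 2\<close> block, in terms of signs: with \<open>\<mu> > \<nu>\<close> the eigenvalues of
  the block, the characteristic polynomial of the full matrix is \<open>\<le> 0\<close> at \<open>\<mu>\<close> and \<open>\<ge> 0\<close> at \<open>\<nu>\<close>.
  At an eigenvalue of the block it reduces to minus the quadratic form of the adjugate of \<open>t - block\<close>
  evaluated at the third column, and this adjugate is positive semidefinite at \<open>\<mu>\<close> and negative
  semidefinite at \<open>\<nu>\<close>.
\<close>

lemma interlacing_signs:
  fixes p q r x y z :: real
  defines "P \<equiv> sym_char_poly p q r x y z"
  assumes pos: "0 < p" "0 < q" "0 < x" "0 < y" "0 < z"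
  obtains \<mu> \<nu> where "\<nu> < \<mu>" "0 < \<mu>" "\<mu> * \<nu> = p * q - x^2" "poly P \<mu> \<le> 0" "0 \<le> poly P \<nu>"
proof -
  define D where "D = sqrt ((p - q)^2 + (2 * x)^2)"
  define \<mu> \<nu> where "\<mu> = (p + q + D) / 2" and "\<nu> = (p + q - D) / 2"
  have D2: "D^2 = (p - q)^2 + (2 * x)^2" by (simp add: D_def)
  have gap: "\<bar>p - q\<bar> < D"
  proof (rule power2_less_imp_less)
    show "\<bar>p - q\<bar>^2 < D^2" using pos by (simp add: D2)
  qed (use pos in \<open>simp add: D_def\<close>)
  \<comment> \<open>Expansion along the third row and column; the first summand vanishes at \<open>\<mu>\<close> and \<open>\<nu>\<close>.\<close>
  have poly_P: "poly P t = (t - r) * ((t - p) * (t - q) - x^2)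
      - (y^2 * (t - q) + z^2 * (t - p) + 2*x*y*z)" for t
    by (simp add: P_def sym_char_poly_def algebra_simps power2_eq_square)
  have roots: "(\<mu> - p) * (\<mu> - q) = x^2" "(\<nu> - p) * (\<nu> - q) = x^2"
  proof -
    have "(\<mu> - p) * (\<mu> - q) = (D^2 - (p - q)^2) / 4" "(\<nu> - p) * (\<nu> - q) = (D^2 - (p - q)^2) / 4"
      by (simp_all add: \<mu>_def \<nu>_def algebra_simps power2_eq_square add_divide_distrib diff_divide_distrib)
    then show "(\<mu> - p) * (\<mu> - q) = x^2" "(\<nu> - p) * (\<nu> - q) = x^2"
      by (simp_all add: D2 power_mult_distrib)
  qed
  have "0 < \<mu> - p" "0 < \<mu> - q" using gap by (auto simp: \<mu>_def)
  then have "0 \<le> y^2 * (\<mu> - q) + z^2 * (\<mu> - p) + 2*x*y*z" using pos by simp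
  then have mu: "poly P \<mu> \<le> 0" unfolding poly_P roots by simp
  define s t where "s = p - \<nu>" and "t = q - \<nu>"
  have st: "0 < s" "0 < t" "s * t = x^2"
    using gap roots(2) by (auto simp: s_def t_def \<nu>_def algebra_simps)
  \<comment> \<open>The arithmetic-geometric mean inequality for \<open>y\<^sup>2 t\<close> and \<open>z\<^sup>2 s\<close>, using \<open>s t = x\<^sup>2\<close>.\<close>
  have "(2*x*y*z)^2 \<le> (y^2 * t + z^2 * s)^2"
  proof -
    have "(y^2 * t + z^2 * s)^2 - 4 * (y^2 * z^2 * (s * t)) = (y^2 * t - z^2 * s)^2"
      by (simp add: algebra_simps power2_eq_square)
    also have "\<dots> \<ge> 0" by simp
    finally show ?thesis by (simp add: st(3) power_mult_distrib algebra_simps)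
  qed
  then have "2*x*y*z \<le> y^2 * t + z^2 * s"
    by (rule power2_le_imp_le) (use st in simp)
  then have nu: "0 \<le> poly P \<nu>"
    unfolding poly_P roots by (simp add: s_def t_def algebra_simps)
  show ?thesis
  proof (rule that[OF _ _ _ mu nu])
    show "\<nu> < \<mu>" "0 < \<mu>" using gap pos by (auto simp: \<mu>_def \<nu>_def)
    show "\<mu> * \<nu> = p * q - x^2"
    proof -
      have "\<mu> * \<nu> = ((p + q)^2 - D^2) / 4"
        by (simp add: \<mu>_def \<nu>_def algebra_simps power2_eq_square)
      also have "\<dots> = ((p + q)^2 - ((p - q)^2 + (2 * x)^2)) / 4" by (simp only: D2)
      also have "\<dots> = p * q - x^2" by (simp add: field_simps power2_eq_square)
      finally show ?thesis .
    qed
  qed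
qed

text \<open>
  If the \<open>2 \<times> 2\<close> minor were positive, both eigenvalues \<open>\<nu> < \<mu>\<close> of the block would be positive, and the
  characteristic polynomial, being \<open>\<le> 0\<close> at \<open>\<mu>\<close>, would have to be negative at \<open>\<nu>\<close>, against
  interlacing. The determinant is minus the value of the characteristic polynomial at \<open>0\<close>.
\<close>

lemma minor_det_of_at_most_one_positive:
  fixes p q r x y z :: real
  defines "P \<equiv> sym_char_poly p q r x y z"
  assumes pos: "0 < p" "0 < q" "0 < x" "0 < y" "0 < z"
    and "size {#t \<in># proots P. 0 < t#} \<le> 1"
  shows "p * q \<le> x^2" and "0 \<le> p*q*r + 2*x*y*z - p*z^2 - q*y^2 - r*x^2"
proof -
  have lead: "P \<noteq> 0" "0 < lead_coeff P" by (simp_all add: P_def sym_char_poly_def)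
  have simple: "\<not> [:-\<alpha>, 1:] * [:-\<beta>, 1:] dvd P" if "0 < \<alpha>" "0 < \<beta>" for \<alpha> \<beta>
    using assms(7) that at_most_one_positive_proot_iff[OF lead(1)] by blast
  obtain \<mu> \<nu> where mn: "\<nu> < \<mu>" "0 < \<mu>" "\<mu> * \<nu> = p * q - x^2" "poly P \<mu> \<le> 0" "0 \<le> poly P \<nu>"
    using interlacing_signs[OF pos, of r] unfolding P_def by blast
  have "\<nu> \<le> 0"
    using negative_left_of_nonpositive_value[OF lead(2) simple mn(4), of \<nu>] mn(1,5) by linarith
  then have "\<mu> * \<nu> \<le> 0" using mn(2) by (simp add: mult_nonneg_nonpos)
  then show "p * q \<le> x^2" using mn(3) by simp
  have "poly P 0 \<le> 0" using nonpositive_at_zero_of_nonpositive_value[OF lead(2) simple mn(4,2)] .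
  then show "0 \<le> p*q*r + 2*x*y*z - p*z^2 - q*y^2 - r*x^2" by (simp add: P_def sym_char_poly_def)
qed

text \<open>
  Descartes' rule of signs, the coefficients \<open>1, - s, m, - d\<close> having at most one sign change: if
  \<open>\<alpha>, \<beta> > 0\<close> are roots and \<open>- u\<close> is the third one, then \<open>- d = \<alpha> \<beta> u\<close> forces \<open>u \<le> 0\<close>, and then
  \<open>m = \<alpha> \<beta> - (\<alpha> + \<beta>) u\<close> is positive.
\<close>

lemma at_most_one_positive_proot_of_signs:
  fixes d m s :: real
  assumes "0 \<le> d" "m \<le> 0"
  shows "size {#t \<in># proots [:-d, m, -s, 1:]. 0 < t#} \<le> 1"
proof -
  have "\<not> [:-\<alpha>, 1:] * [:-\<beta>, 1:] dvd [:-d, m, -s, 1:]" if pos: "0 < \<alpha>" "0 < \<beta>" for \<alpha> \<beta>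
  proof
    assume "[:-\<alpha>, 1:] * [:-\<beta>, 1:] dvd [:-d, m, -s, 1:]"
    then obtain Q where Q: "[:-d, m, -s, 1:] = [:-\<alpha>, 1:] * [:-\<beta>, 1:] * Q" by (elim dvdE)
    then have "Q \<noteq> 0" by auto
    have "degree [:-d, m, -s, 1:] = degree ([:-\<alpha>, 1:] * [:-\<beta>, 1:]) + degree Q"
      unfolding Q by (rule degree_mult_eq) (use \<open>Q \<noteq> 0\<close> in auto)
    then have "degree Q = 1" by simp
    then obtain u v where uv: "Q = [:u, v:]" using degree1_coeffs by blast
    have "v = 1" "m = \<alpha> * \<beta> + (\<alpha> + \<beta>) * - u" "-d = \<alpha> * \<beta> * u"
      using Q unfolding uv by (auto simp: algebra_simps)
    moreover have "0 < \<alpha> * \<beta>" "0 < \<alpha> + \<beta>" using pos by auto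
    ultimately have "u \<le> 0"
      using assms(1) by (metis neg_le_0_iff_le mult_le_0_iff not_less)
    then have "(\<alpha> + \<beta>) * u \<le> 0" using pos by (simp add: mult_nonneg_nonpos)
    with \<open>m = _\<close> \<open>0 < \<alpha> * \<beta>\<close> assms(2) show False by simp
  qed
  then show ?thesis by (subst at_most_one_positive_proot_iff) auto
qed

text \<open>
  Scaling rows and columns by the same positive diagonal matrix preserves the signature and can make
  all off-diagonal entries equal to \<open>1\<close>; then \<open>u, v, w\<close> are the diagonal entries. The four conditions
  say that the principal \<open>2 \<times> 2\<close> minors of this normal form are \<open>\<le> 0\<close> and its determinant is \<open>\<ge> 0\<close>.
  Such a scaling changes the characteristic polynomial, so the proof works with the minors and the
  determinant of the original matrix, whose signs are the same.
\<close>

lemma at_most_one_positive_sym_iff: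
  fixes p q r x y z :: real
  assumes pos: "0 < p" "0 < q" "0 < r" "0 < x" "0 < y" "0 < z"
  defines "u \<equiv> p * z / (x * y)" and "v \<equiv> q * y / (x * z)" and "w \<equiv> r * x / (y * z)"
  shows "size {#t \<in># proots (sym_char_poly p q r x y z). 0 < t#} \<le> 1 \<longleftrightarrow>
    u * v \<le> 1 \<and> u * w \<le> 1 \<and> v * w \<le> 1 \<and> u + v + w \<le> 2 + u * v * w"
proof -
  let ?one = "size {#t \<in># proots (sym_char_poly p q r x y z). 0 < t#} \<le> 1"
  let ?d = "p*q*r + 2*x*y*z - p*z^2 - q*y^2 - r*x^2"
  have "u * v = p * q / x^2" "u * w = p * r / y^2" "v * w = q * r / z^2"
    using pos by (simp_all add: u_def v_def w_def power2_eq_square field_simps)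
  then have minors: "u * v \<le> 1 \<longleftrightarrow> p * q \<le> x^2" "u * w \<le> 1 \<longleftrightarrow> p * r \<le> y^2"
    "v * w \<le> 1 \<longleftrightarrow> q * r \<le> z^2"
    using pos by (simp_all add: divide_le_eq)
  have "?d = x * y * z * (2 + u * v * w - (u + v + w))"
    using pos by (simp add: u_def v_def w_def power2_eq_square field_simps)
  moreover have "0 < x * y * z" using pos by simp
  ultimately have det: "u + v + w \<le> 2 + u * v * w \<longleftrightarrow> 0 \<le> ?d"
    by (simp only: right_diff_distrib diff_ge_0_iff_ge mult_le_cancel_left_pos)
  have perm: "sym_char_poly p q r x y z = sym_char_poly p r q y x z"
    "sym_char_poly p q r x y z = sym_char_poly q r p z x y"
    by (simp_all add: sym_char_poly_def algebra_simps)
  show ?thesis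
    unfolding minors det
  proof
    assume ?one
    then show "p * q \<le> x^2 \<and> p * r \<le> y^2 \<and> q * r \<le> z^2 \<and> 0 \<le> ?d"
      using minor_det_of_at_most_one_positive[of p q x y z r]
        minor_det_of_at_most_one_positive[of p r y x z q]
        minor_det_of_at_most_one_positive[of q r z x y p] pos perm by simp
  next
    assume "p * q \<le> x^2 \<and> p * r \<le> y^2 \<and> q * r \<le> z^2 \<and> 0 \<le> ?d"
    then show ?one
      unfolding sym_char_poly_def by (intro at_most_one_positive_proot_of_signs) auto
  qed
qed

section \<open>Local ratios of Lorentzian cubics\<close>

lemma ball_index_iff:
  fixes P :: "nat \<Rightarrow> bool"
  shows "(\<forall>i\<in>{1..3}. P i) \<longleftrightarrow> P 1 \<and> P 2 \<and> P 3"
proof -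
  have "{1..3::nat} = {1, 2, 3}" by auto
  then show ?thesis by simp
qed

lemma Delta33_eq:
  "Delta33 = {(3,0,0), (0,3,0), (0,0,3), (2,1,0), (2,0,1), (1,2,0), (0,2,1), (1,0,2), (0,1,2), (1,1,1)}"
proof -
  have "(x, y, z) \<in> Delta33 \<longleftrightarrow> (x, y, z) \<in>
    {(3,0,0), (0,3,0), (0,0,3), (2,1,0), (2,0,1), (1,2,0), (0,2,1), (1,0,2), (0,1,2), (1,1,1)}" for x y z
    unfolding Delta33_def by (simp, arith)
  then show ?thesis by (simp only: set_eq_iff split_paired_All) blast
qed

lemma local_ratio_simps:
  fixes f :: polynomial3
  defines "c \<equiv> \<lambda>a1 a2 a3. ncoeff f (a1, a2, a3)"
  shows "local_ratio 1 1 f = c 1 1 1 * c 3 0 0 / (c 2 1 0 * c 2 0 1)"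
    "local_ratio 1 2 f = c 2 0 1 * c 1 2 0 / (c 2 1 0 * c 1 1 1)"
    "local_ratio 1 3 f = c 2 1 0 * c 1 0 2 / (c 2 0 1 * c 1 1 1)"
    "local_ratio 2 1 f = c 0 2 1 * c 2 1 0 / (c 1 2 0 * c 1 1 1)"
    "local_ratio 2 2 f = c 1 1 1 * c 0 3 0 / (c 1 2 0 * c 0 2 1)"
    "local_ratio 2 3 f = c 1 2 0 * c 0 1 2 / (c 1 1 1 * c 0 2 1)"
    "local_ratio 3 1 f = c 0 1 2 * c 2 0 1 / (c 1 1 1 * c 1 0 2)"
    "local_ratio 3 2 f = c 1 0 2 * c 0 2 1 / (c 1 1 1 * c 0 1 2)"
    "local_ratio 3 3 f = c 1 1 1 * c 0 0 3 / (c 1 0 2 * c 0 1 2)"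
  by (simp_all add: local_ratio_def c_def numeral_2_eq_2[symmetric] del: One_nat_def)

text \<open>
  The three ratios in row \<open>i\<close> are the diagonal entries of the normal form of the \<open>i\<close>th coefficient
  matrix.
\<close>

lemma row_condition_iff:
  assumes pos: "\<forall>\<alpha>\<in>Delta33. 0 < ncoeff f \<alpha>"
  shows "\<forall>i\<in>{1..3}. at_most_one_positive_eigenvalue (coeff_matrix f i) \<longleftrightarrow>
    (let u = local_ratio i 1 f; v = local_ratio i 2 f; w = local_ratio i 3 f in
      u * v \<le> 1 \<and> u * w \<le> 1 \<and> v * w \<le> 1 \<and> u + v + w \<le> 2 + u * v * w)"
proof -
  let ?c = "\<lambda>a1 a2 a3. ncoeff f (a1, a2, a3)"
  have "char_poly (coeff_matrix f 1) =
      sym_char_poly (?c 3 0 0) (?c 1 2 0) (?c 1 0 2) (?c 2 1 0) (?c 2 0 1) (?c 1 1 1)"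
    "char_poly (coeff_matrix f 2) =
      sym_char_poly (?c 2 1 0) (?c 0 3 0) (?c 0 1 2) (?c 1 2 0) (?c 1 1 1) (?c 0 2 1)"
    "char_poly (coeff_matrix f 3) =
      sym_char_poly (?c 2 0 1) (?c 0 2 1) (?c 0 0 3) (?c 1 1 1) (?c 1 0 2) (?c 0 1 2)"
    unfolding coeff_matrix_def
    by (rule char_poly_symmetric_3; simp add: unit_exponent_def eval_nat_numeral)+
  moreover have "0 < ?c 3 0 0" "0 < ?c 0 3 0" "0 < ?c 0 0 3" "0 < ?c 2 1 0" "0 < ?c 2 0 1"
    "0 < ?c 1 2 0" "0 < ?c 0 2 1" "0 < ?c 1 0 2" "0 < ?c 0 1 2" "0 < ?c 1 1 1"
    using pos by (simp_all add: Delta33_eq)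
  ultimately show ?thesis
    unfolding ball_index_iff at_most_one_positive_eigenvalue_def local_ratio_simps Let_def
    by (simp only: at_most_one_positive_sym_iff) (simp add: mult.commute)
qed

lemma local_ratio_pos:
  assumes "f \<in> full_support_lorentzian_cubics" "i \<in> {1..3}" "j \<in> {1..3}"
  shows "0 < local_ratio i j f"
proof -
  have "\<forall>\<alpha>\<in>Delta33. 0 < ncoeff f \<alpha>"
    using assms(1) by (simp add: full_support_lorentzian_cubics_def)
  then have "\<forall>i\<in>{1..3}. \<forall>j\<in>{1..3}. 0 < local_ratio i j f"
    unfolding ball_index_iff local_ratio_simps by (simp add: Delta33_eq)
  with assms(2,3) show ?thesis by blast
qed

text \<open>
  With \<open>u v \<le> 1\<close> the determinant condition reads \<open>u + v \<le> 2 - w (1 - u v) \<le> 2\<close>.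
\<close>

lemma local_ratio_add_le_2:
  assumes f: "f \<in> full_support_lorentzian_cubics" and "i \<in> {1..3}" "j \<in> {1..3}" "l \<in> {1..3}" "j \<noteq> l"
  shows "local_ratio i j f + local_ratio i l f \<le> 2"
proof -
  have step: "u + v \<le> 2" if "0 < w" "u * v \<le> 1" "u + v + w \<le> 2 + u * v * w" for u v w :: real
    using that mult_right_mono[OF that(2) less_imp_le[OF that(1)]] by linarith
  let ?u = "local_ratio i 1 f" and ?v = "local_ratio i 2 f" and ?w = "local_ratio i 3 f"
  have "0 < ?u" "0 < ?v" "0 < ?w" using local_ratio_pos[OF f assms(2)] by auto
  moreover have "?u * ?v \<le> 1 \<and> ?u * ?w \<le> 1 \<and> ?v * ?w \<le> 1 \<and> ?u + ?v + ?w \<le> 2 + ?u * ?v * ?w"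
    using f assms(2) row_condition_iff[of f]
    by (simp add: full_support_lorentzian_cubics_def Let_def)
  ultimately have "?u + ?v \<le> 2" "?u + ?w \<le> 2" "?v + ?w \<le> 2"
    using step[of ?w ?u ?v] step[of ?v ?u ?w] step[of ?u ?v ?w] by (simp_all add: algebra_simps)
  then have "\<forall>j\<in>{1..3}. \<forall>l\<in>{1..3}. j \<noteq> l \<longrightarrow> local_ratio i j f + local_ratio i l f \<le> 2"
    unfolding ball_index_iff by (simp add: add.commute)
  with assms(3-5) show ?thesis by blast
qed

lemma local_ratio_le_2:
  assumes "f \<in> full_support_lorentzian_cubics" "i \<in> {1..3}" "j \<in> {1..3}"
  shows "local_ratio i j f \<le> 2"
proof -
  obtain l where "l \<in> {1..3}" "j \<noteq> l"
    using assms(3) by (cases "j = 1") (auto intro: that[of 1] that[of 2])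
  then show ?thesis
    using local_ratio_add_le_2[OF assms, of l] local_ratio_pos[OF assms(1,2), of l] by linarith
qed

text \<open>
  The product of a transposed pair equals the product of the two off-diagonal ratios in the remaining
  row, and that product is bounded by the corresponding \<open>2 \<times> 2\<close> minor.
\<close>

lemma transposed_ratio_mult_le_1:
  assumes f: "f \<in> full_support_lorentzian_cubics" and "i \<in> {1..3}" "j \<in> {1..3}" "i \<noteq> j"
  shows "local_ratio i j f * local_ratio j i f \<le> 1"
proof -
  have pos: "\<forall>\<alpha>\<in>Delta33. 0 < ncoeff f \<alpha>"
    using f by (simp add: full_support_lorentzian_cubics_def)
  have "\<forall>i\<in>{1..3}. local_ratio i 1 f * local_ratio i 2 f \<le> 1 \<and>
      local_ratio i 1 f * local_ratio i 3 f \<le> 1 \<and> local_ratio i 2 f * local_ratio i 3 f \<le> 1"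
    using f row_condition_iff[of f]
    by (simp add: full_support_lorentzian_cubics_def Let_def)
  moreover have "local_ratio 1 2 f * local_ratio 2 1 f = local_ratio 3 1 f * local_ratio 3 2 f"
    "local_ratio 1 3 f * local_ratio 3 1 f = local_ratio 2 1 f * local_ratio 2 3 f"
    "local_ratio 2 3 f * local_ratio 3 2 f = local_ratio 1 2 f * local_ratio 1 3 f"
    using pos unfolding local_ratio_simps by (simp_all add: Delta33_eq field_simps)
  ultimately have "\<forall>i\<in>{1..3}. \<forall>j\<in>{1..3}. i \<noteq> j \<longrightarrow> local_ratio i j f * local_ratio j i f \<le> 1"
    unfolding ball_index_iff by (simp add: mult.commute)
  with assms(2-4) show ?thesis by blast
qed

text \<open>
  The two equations, which imply the third one of their kind, are the only algebraic relations
  between the nine ratios. A row sum of at most \<open>2\<close> is a convenient sufficient condition for the row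
  to be Lorentzian.
\<close>

lemma lorentzian_of_ratio_table:
  fixes r :: "nat \<Rightarrow> nat \<Rightarrow> real"
  assumes pos: "\<forall>i\<in>{1..3}. \<forall>j\<in>{1..3}. 0 < r i j"
    and rows: "\<forall>i\<in>{1..3}. r i 1 + r i 2 + r i 3 \<le> 2"
    and rel: "r 1 2 * r 1 3 = r 2 3 * r 3 2" "r 2 1 * r 2 3 = r 1 3 * r 3 1"
  obtains f where "f \<in> full_support_lorentzian_cubics"
    and "\<forall>i\<in>{1..3}. \<forall>j\<in>{1..3}. local_ratio i j f = r i j"
proof -
  \<comment> \<open>Rescaling the variables and the polynomial allows to take
    \<open>c\<^sub>1\<^sub>1\<^sub>1 = c\<^sub>2\<^sub>1\<^sub>0 = c\<^sub>2\<^sub>0\<^sub>1 = 1\<close>; solving for the other coefficients gives these values.\<close>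
  define c :: "exponent \<Rightarrow> real" where "c =
    (\<lambda>_. 1)((1,2,0) := r 1 2, (1,0,2) := r 1 3, (0,2,1) := r 2 1 * r 1 2, (0,1,2) := r 3 1 * r 1 3,
      (3,0,0) := r 1 1, (0,3,0) := r 2 2 * r 2 1 * r 1 2^2, (0,0,3) := r 3 3 * r 3 1 * r 1 3^2)"
  define f where "f = (\<Sum>\<alpha>\<in>Delta33. Poly_Mapping.single \<alpha> (c \<alpha> / exponent_fact \<alpha>))"
  have fin: "finite Delta33" by (simp add: Delta33_eq)
  have fact: "exponent_fact \<alpha> \<noteq> 0" for \<alpha> by (cases \<alpha>) (simp add: exponent_fact_def)
  have coeff: "ncoeff f \<alpha> = c \<alpha>" if "\<alpha> \<in> Delta33" for \<alpha>
    using that fin fact by (simp add: ncoeff_def f_def lookup_sum lookup_single when_def)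
  have rpos: "0 < r 1 1" "0 < r 1 2" "0 < r 1 3" "0 < r 2 1" "0 < r 2 2" "0 < r 2 3"
    "0 < r 3 1" "0 < r 3 2" "0 < r 3 3" using pos by auto
  then have "\<forall>\<alpha>\<in>Delta33. 0 < c \<alpha>" by (simp add: Delta33_eq c_def)
  then have fpos: "\<forall>\<alpha>\<in>Delta33. 0 < ncoeff f \<alpha>" by (simp add: coeff)
  have "r 2 3 = r 1 3 * r 3 1 / r 2 1" using rel(2) rpos by (simp add: field_simps)
  moreover from this have "r 3 2 = r 1 2 * r 2 1 / r 3 1" using rel(1) rpos by (simp add: field_simps)
  ultimately have ratios: "\<forall>i\<in>{1..3}. \<forall>j\<in>{1..3}. local_ratio i j f = r i j"
    using rpos unfolding ball_index_iff local_ratio_simps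
    by (simp add: coeff Delta33_eq) (simp add: c_def field_simps power2_eq_square)
  have mult_le: "x * y \<le> 1" if "0 < x" "0 < y" "x + y \<le> 2" for x y :: real
  proof -
    have "4 * (x * y) = (x + y)^2 - (x - y)^2" by (simp add: power2_eq_square algebra_simps)
    also have "\<dots> \<le> 2^2 - 0" using that by (intro diff_mono power_mono) auto
    finally show ?thesis by simp
  qed
  have "\<forall>i\<in>{1..3}. at_most_one_positive_eigenvalue (coeff_matrix f i)"
  proof
    fix i :: nat assume i: "i \<in> {1..3}"
    have p: "0 < r i 1" "0 < r i 2" "0 < r i 3" and s: "r i 1 + r i 2 + r i 3 \<le> 2"
      using pos rows i by auto
    moreover have "0 < r i 1 * r i 2 * r i 3" using p by simp
    then have "r i 1 + r i 2 + r i 3 \<le> 2 + r i 1 * r i 2 * r i 3" using s by linarith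
    moreover have "local_ratio i 1 f = r i 1" "local_ratio i 2 f = r i 2" "local_ratio i 3 f = r i 3"
      using ratios i by auto
    ultimately show "at_most_one_positive_eigenvalue (coeff_matrix f i)"
      using row_condition_iff[OF fpos] i by (simp add: Let_def mult_le)
  qed
  moreover have "f = (\<Sum>\<alpha>\<in>Delta33. Poly_Mapping.single \<alpha> (ncoeff f \<alpha> / exponent_fact \<alpha>))"
    by (subst (1) f_def, rule sum.cong) (simp_all add: coeff)
  ultimately have "f \<in> full_support_lorentzian_cubics"
    using fpos by (simp add: full_support_lorentzian_cubics_def)
  then show ?thesis using that ratios by blast
qed

section \<open>Tables approached by ratios of Lorentzian cubics\<close>

lemma rpow_mono:
  assumes "0 \<le> x" "x \<le> y" "0 \<le> e"
  shows "rpow x e \<le> rpow y e"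
  using assms by (simp add: rpow_def powr_mono2)

lemma rpow_nonneg: "0 \<le> rpow x e"
  by (simp add: rpow_def)

lemma rpow_eq_powr: "0 < x \<Longrightarrow> rpow x e = x powr e"
  by (simp add: rpow_def)

lemma rpow_mult: "0 \<le> x \<Longrightarrow> 0 \<le> y \<Longrightarrow> rpow (x * y) e = rpow x e * rpow y e"
  by (simp add: rpow_def powr_mult)

lemma sup_ratio_powers_commute:
  "sup_ratio_powers (i, j) (k, l) a b = sup_ratio_powers (k, l) (i, j) b a"
  by (simp add: sup_ratio_powers_def mult.commute)

text \<open>
  The suprema need not be attained. A table is approached if, shrunk by any factor \<open>\<theta> < 1\<close>, it is
  dominated entrywise by the ratios of some Lorentzian cubic; its entries at positions of no interest may therefore be \<open>0\<close>.
\<close>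

definition approached_table :: "(nat \<Rightarrow> nat \<Rightarrow> real) \<Rightarrow> bool" where
  "approached_table w \<longleftrightarrow> (\<forall>\<theta>. 0 < \<theta> \<and> \<theta> < 1 \<longrightarrow>
     (\<exists>f\<in>full_support_lorentzian_cubics. \<forall>i\<in>{1..3}. \<forall>j\<in>{1..3}. \<theta> * w i j \<le> local_ratio i j f))"

text \<open>
  The ratios dominating \<open>\<theta> w\<close> give the lower bound \<open>\<theta> powr (a + b)\<close> times the claimed value, and
  \<open>\<theta>\<close> tends to \<open>1\<close>.
\<close>

lemma sup_ratio_powers_eqI:
  assumes table: "approached_table w" and nonneg: "0 \<le> w i j" "0 \<le> w k l"
    and idx: "i \<in> {1..3}" "j \<in> {1..3}" "k \<in> {1..3}" "l \<in> {1..3}" and ab: "0 \<le> a" "0 \<le> b"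
    and upper: "\<And>f. f \<in> full_support_lorentzian_cubics \<Longrightarrow>
      rpow (local_ratio i j f) a * rpow (local_ratio k l f) b \<le> rpow (w i j) a * rpow (w k l) b"
  shows "sup_ratio_powers (i, j) (k, l) a b = ereal (rpow (w i j) a * rpow (w k l) b)"
proof (rule antisym)
  let ?S = "rpow (w i j) a * rpow (w k l) b"
  show "sup_ratio_powers (i, j) (k, l) a b \<le> ereal ?S"
    using upper by (auto simp: sup_ratio_powers_def intro: SUP_least)
  have below: "ereal (\<theta> powr (a + b) * ?S) \<le> sup_ratio_powers (i, j) (k, l) a b"
    if th: "0 < \<theta>" "\<theta> < 1" for \<theta>
  proof -
    obtain f where f: "f \<in> full_support_lorentzian_cubics"
      and ge: "\<theta> * w i j \<le> local_ratio i j f" "\<theta> * w k l \<le> local_ratio k l f"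
      using table th idx unfolding approached_table_def by blast
    have "\<theta> powr (a + b) * ?S = rpow (\<theta> * w i j) a * rpow (\<theta> * w k l) b"
      using th nonneg by (simp add: rpow_mult rpow_eq_powr powr_add)
    also have "\<dots> \<le> rpow (local_ratio i j f) a * rpow (local_ratio k l f) b"
      using ge nonneg th ab by (intro mult_mono rpow_mono rpow_nonneg) auto
    finally have "ereal (\<theta> powr (a + b) * ?S)
        \<le> ereal (rpow (local_ratio i j f) a * rpow (local_ratio k l f) b)" by simp
    also have "\<dots> \<le> sup_ratio_powers (i, j) (k, l) a b"
      unfolding sup_ratio_powers_def prod.case using f by (rule SUP_upper)
    finally show ?thesis .
  qed
  have "((\<lambda>\<theta>. \<theta> powr (a + b) * ?S) \<longlongrightarrow> 1 powr (a + b) * ?S) (at_left 1)"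
    by (intro tendsto_intros) auto
  then have lim: "((\<lambda>\<theta>. ereal (\<theta> powr (a + b) * ?S)) \<longlongrightarrow> ereal ?S) (at_left 1)"
    by simp
  have "eventually (\<lambda>\<theta>::real. \<theta> \<in> {0<..<1}) (at_left 1)"
    by (rule eventually_at_left_real) simp
  then have "eventually (\<lambda>\<theta>. ereal (\<theta> powr (a + b) * ?S) \<le> sup_ratio_powers (i, j) (k, l) a b) (at_left 1)"
    by eventually_elim (use below in auto)
  then show "ereal ?S \<le> sup_ratio_powers (i, j) (k, l) a b"
    by (rule tendsto_upperbound[OF lim]) simp
qed

lemma approached_tableI:
  assumes "\<And>\<theta>. 0 < \<theta> \<Longrightarrow> \<theta> < 1 \<Longrightarrow> \<exists>r :: nat \<Rightarrow> nat \<Rightarrow> real.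
      (\<forall>i\<in>{1..3}. \<forall>j\<in>{1..3}. 0 < r i j \<and> \<theta> * w i j \<le> r i j) \<and>
      (\<forall>i\<in>{1..3}. r i 1 + r i 2 + r i 3 \<le> 2) \<and>
      r 1 2 * r 1 3 = r 2 3 * r 3 2 \<and> r 2 1 * r 2 3 = r 1 3 * r 3 1"
  shows "approached_table w"
  unfolding approached_table_def
proof (intro allI impI)
  fix \<theta> :: real assume "0 < \<theta> \<and> \<theta> < 1"
  with assms obtain r where "\<forall>i\<in>{1..3}. \<forall>j\<in>{1..3}. 0 < r i j \<and> \<theta> * w i j \<le> r i j"
    "\<forall>i\<in>{1..3}. r i 1 + r i 2 + r i 3 \<le> 2"
    "r 1 2 * r 1 3 = r 2 3 * r 3 2" "r 2 1 * r 2 3 = r 1 3 * r 3 1"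
    by blast
  moreover from this obtain f where "f \<in> full_support_lorentzian_cubics"
    "\<forall>i\<in>{1..3}. \<forall>j\<in>{1..3}. local_ratio i j f = r i j"
    using lorentzian_of_ratio_table[of r] by blast
  ultimately show "\<exists>f\<in>full_support_lorentzian_cubics. \<forall>i\<in>{1..3}. \<forall>j\<in>{1..3}. \<theta> * w i j \<le> local_ratio i j f"
    by (metis (no_types, lifting))
qed

text \<open>
  Tables with equal rows satisfy the two relations identically.
\<close>

lemma approached_table_columns:
  assumes nonneg: "\<forall>j\<in>{1..3}. 0 \<le> m j" and sum: "m 1 + m 2 + m 3 \<le> 2"
  shows "approached_table (\<lambda>i j. m j)"
proof (rule approached_tableI)
  fix \<theta> :: real assume th: "0 < \<theta>" "\<theta> < 1"
  \<comment> \<open>The weights \<open>\<theta>\<close> and \<open>1 - \<theta>\<close> mix \<open>m\<close> with the constant row \<open>2/3, 2/3, 2/3\<close> of sum \<open>2\<close>, which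
    makes the entries positive.\<close>
  define d where "d = (1 - \<theta>) * (2 / 3)"
  have d: "0 < d" "2 - 3 * d = 2 * \<theta>" using th by (auto simp: d_def field_simps)
  let ?r = "\<lambda>(i::nat) j. \<theta> * m j + d"
  have "\<theta> * (m 1 + m 2 + m 3) \<le> \<theta> * 2" using sum th by simp
  then have "?r i 1 + ?r i 2 + ?r i 3 \<le> 2" for i
    using d unfolding distrib_left by linarith
  then show "\<exists>r :: nat \<Rightarrow> nat \<Rightarrow> real. (\<forall>i\<in>{1..3}. \<forall>j\<in>{1..3}. 0 < r i j \<and> \<theta> * m j \<le> r i j) \<and>
      (\<forall>i\<in>{1..3}. r i 1 + r i 2 + r i 3 \<le> 2) \<and>
      r 1 2 * r 1 3 = r 2 3 * r 3 2 \<and> r 2 1 * r 2 3 = r 1 3 * r 3 1"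
    using th nonneg d by (intro exI[of _ ?r]) (auto intro: add_nonneg_pos)
qed

text \<open>
  Besides the scalings of the columns, the off-diagonal relations admit one more degree of freedom:
  multiplying \<open>R\<^sub>1\<^sub>2, R\<^sub>2\<^sub>3, R\<^sub>3\<^sub>1\<close> by \<open>\<lambda>\<close> and \<open>R\<^sub>1\<^sub>3, R\<^sub>2\<^sub>1, R\<^sub>3\<^sub>2\<close> by \<open>1/\<lambda>\<close>. As \<open>\<lambda>\<close> tends to \<open>0\<close> or
  infinity, one of the two cyclic triples becomes negligible, while scaling the columns accordingly keeps
  the other one at arbitrary values.
\<close>

lemma approached_table_oriented:
  assumes nonneg: "\<forall>i\<in>{1..3}. \<forall>j\<in>{1..3}. 0 \<le> w i j"
    and rows: "\<forall>i\<in>{1..3}. w i 1 + w i 2 + w i 3 \<le> 2"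
    and oriented: "w 1 3 = 0 \<and> w 2 1 = 0 \<and> w 3 2 = 0 \<or> w 1 2 = 0 \<and> w 2 3 = 0 \<and> w 3 1 = 0"
  shows "approached_table w"
proof (rule approached_tableI)
  fix \<theta> :: real assume th: "0 < \<theta>" "\<theta> < 1"
  \<comment> \<open>The entries \<open>p i j\<close> leave a slack of \<open>3 d\<close> in each row, which pays for its negligible entry of size
    at most \<open>2 d\<close>.\<close>
  define d where "d = (1 - \<theta>) / 3"
  have d: "0 < d" "\<theta> = 1 - 3 * d" using th by (auto simp: d_def field_simps)
  define p where "p i j = \<theta> * w i j + d" for i j
  have p_pos: "\<forall>i\<in>{1..3}. \<forall>j\<in>{1..3}. 0 < p i j"
    using nonneg th d unfolding p_def by (auto intro: add_nonneg_pos)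
  have p_ge: "\<theta> * w i j \<le> p i j" for i j using d by (simp add: p_def)
  have p_row: "\<forall>i\<in>{1..3}. p i 1 + p i 2 + p i 3 \<le> 2 - 3 * d"
  proof
    fix i :: nat assume "i \<in> {1..3}"
    then have "\<theta> * (w i 1 + w i 2 + w i 3) \<le> \<theta> * 2"
      using rows th by (intro mult_left_mono) auto
    then show "p i 1 + p i 2 + p i 3 \<le> 2 - 3 * d"
      using d unfolding p_def distrib_left by linarith
  qed
  have p_le: "\<forall>i\<in>{1..3}. \<forall>j\<in>{1..3}. d * p i j \<le> 2 * d"
  proof (intro ballI)
    fix i j :: nat assume "i \<in> {1..3}" "j \<in> {1..3}"
    moreover have "\<forall>i\<in>{1..3}. \<forall>j\<in>{1..3}. p i j \<le> 2"
      using p_row p_pos d unfolding ball_index_iff by linarith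
    ultimately show "d * p i j \<le> 2 * d" using d by (simp add: mult.commute)
  qed
  \<comment> \<open>Each negligible entry is \<open>d\<close> times the other off-diagonal entry of its column.\<close>
  define q where "q i j = d * p i j" for i j
  have q: "\<forall>i\<in>{1..3}. \<forall>j\<in>{1..3}. 0 < q i j \<and> q i j \<le> 2 * d"
    using p_pos p_le d by (simp add: q_def)
  have q_rel: "p i j * q k l = p k l * q i j" "q i j * p k l = q k l * p i j" for i j k l
    by (simp_all add: q_def)
  let ?t = "\<lambda>xs i j. (xs :: real list list) ! (i - 1) ! (j - 1)"
  let ?P = "?t [[p 1 1, p 1 2, q 2 3], [q 3 1, p 2 2, p 2 3], [p 3 1, q 1 2, p 3 3]]"
  let ?N = "?t [[p 1 1, q 3 2, p 1 3], [p 2 1, p 2 2, q 1 3], [q 2 1, p 3 2, p 3 3]]"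
  let ?good = "\<lambda>r :: nat \<Rightarrow> nat \<Rightarrow> real. (\<forall>i\<in>{1..3}. \<forall>j\<in>{1..3}. 0 < r i j \<and> \<theta> * w i j \<le> r i j) \<and>
      (\<forall>i\<in>{1..3}. r i 1 + r i 2 + r i 3 \<le> 2) \<and>
      r 1 2 * r 1 3 = r 2 3 * r 3 2 \<and> r 2 1 * r 2 3 = r 1 3 * r 3 1"
  from oriented show "\<exists>r. ?good r"
  proof
    assume z: "w 1 3 = 0 \<and> w 2 1 = 0 \<and> w 3 2 = 0"
    have "?good ?P"
      using p_pos p_ge p_row q d(1) z unfolding ball_index_iff
      by (auto simp: q_rel simp del: One_nat_def)
    then show ?thesis by (rule exI[of ?good ?P])
  next
    assume z: "w 1 2 = 0 \<and> w 2 3 = 0 \<and> w 3 1 = 0"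
    have "?good ?N"
      using p_pos p_ge p_row q d(1) z unfolding ball_index_iff
      by (auto simp: q_rel simp del: One_nat_def)
    then show ?thesis by (rule exI[of ?good ?N])
  qed
qed

text \<open>
  The row of the third index has off-diagonal entries \<open>\<theta>, \<theta>\<close>, so that the product of the transposed pair,
  \<open>2 \<theta> * (\<theta> / 2)\<close>, equals theirs as required; this is why \<open>1/2\<close> is paired with \<open>2\<close>. The remaining relation forces the entries \<open>e\<close> and \<open>2 e\<close> in
  the column of the third index, and \<open>e\<close> can be chosen small.
\<close>

lemma approached_table_transposed:
  assumes "i \<in> {1..3}" "j \<in> {1..3}" "i \<noteq> j"
  shows "approached_table (\<lambda>x y. if (x, y) = (i, j) then 2 else if (x, y) = (j, i) then 1 / 2 else 0)"
    (is "approached_table ?w")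
proof (rule approached_tableI)
  fix \<theta> :: real assume th: "0 < \<theta>" "\<theta> < 1"
  define e where "e = (1 - \<theta>) / 2"
  have e: "0 < e" "\<theta> = 1 - 2 * e" using th by (auto simp: e_def field_simps)
  let ?r = "\<lambda>x y. if x = y then e else if (x, y) = (i, j) then 2 * \<theta> else if (x, y) = (j, i) then \<theta> / 2
     else if y = i \<or> y = j then \<theta> else if x = i then e else 2 * e"
  have "i = 1 \<or> i = 2 \<or> i = 3" "j = 1 \<or> j = 2 \<or> j = 3" using assms(1,2) by auto
  then show "\<exists>r :: nat \<Rightarrow> nat \<Rightarrow> real. (\<forall>x\<in>{1..3}. \<forall>y\<in>{1..3}. 0 < r x y \<and> \<theta> * ?w x y \<le> r x y) \<and>
      (\<forall>x\<in>{1..3}. r x 1 + r x 2 + r x 3 \<le> 2) \<and>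
      r 1 2 * r 1 3 = r 2 3 * r 3 2 \<and> r 2 1 * r 2 3 = r 1 3 * r 3 1"
    using assms(3) e th unfolding ball_index_iff
    by (intro exI[of _ ?r]) (elim disjE; simp; simp add: field_simps)
qed

section \<open>The three suprema\<close>

text \<open>
  The maximum on \<open>u + v = 2\<close> is at \<open>U = 2 a / (a + b)\<close>, \<open>V = 2 b / (a + b)\<close>. Comparing logarithms, the
  tangent bound \<open>ln t \<le> t - 1\<close> at \<open>u / U\<close> and \<open>v / V\<close> suffices.
\<close>

lemma weighted_amgm_bound:
  fixes u v a b :: real
  assumes "0 < u" "0 < v" "u + v \<le> 2" "0 \<le> a" "0 \<le> b" "0 < a + b"
  shows "rpow u a * rpow v b \<le> rpow (2 * a / (a + b)) a * rpow (2 * b / (a + b)) b"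
proof -
  consider "a = 0" | "b = 0" | "0 < a" "0 < b" using assms by linarith
  then show ?thesis
  proof cases
    case 1
    then show ?thesis using assms rpow_mono[of v 2 b] by (simp add: rpow_def)
  next
    case 2
    then show ?thesis using assms rpow_mono[of u 2 a] by (simp add: rpow_def)
  next
    case 3
    define U V where "U = 2 * a / (a + b)" and "V = 2 * b / (a + b)"
    have UV: "0 < U" "0 < V" using 3 by (simp_all add: U_def V_def)
    have aU: "a / U = (a + b) / 2" "b / V = (a + b) / 2"
      using 3 by (simp_all add: U_def V_def)
    have "ln (u / U) \<le> u / U - 1" "ln (v / V) \<le> v / V - 1"
      using assms UV by (auto intro!: ln_le_minus_one)
    then have "a * ln (u / U) + b * ln (v / V) \<le> a * (u / U - 1) + b * (v / V - 1)"
      using 3 by (intro add_mono mult_left_mono) auto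
    also have "\<dots> = a / U * u + b / V * v - (a + b)" by (simp add: algebra_simps)
    also have "\<dots> = (a + b) / 2 * (u + v) - (a + b)" by (simp only: aU distrib_left)
    also have "\<dots> \<le> (a + b) / 2 * 2 - (a + b)"
      using assms by (intro diff_mono mult_left_mono) auto
    finally have "a * ln u + b * ln v \<le> a * ln U + b * ln V"
      using assms UV by (simp add: ln_div algebra_simps)
    then have "u powr a * v powr b \<le> U powr a * V powr b"
      using assms UV by (simp add: powr_def exp_add[symmetric])
    then show ?thesis using assms UV by (simp add: rpow_eq_powr U_def V_def)
  qed
qed

lemma sup_same_row:
  assumes idx: "i \<in> {1..3}" "j \<in> {1..3}" "l \<in> {1..3}" "j \<noteq> l" and ab: "0 \<le> a" "0 \<le> b"
  shows "sup_ratio_powers (i, j) (i, l) a b =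
    ereal (2 powr (a + b) * (rpow a a * rpow b b / rpow (a + b) (a + b)))"
proof (cases "a + b = 0")
  case True
  then have "a = 0" "b = 0" using ab by auto
  moreover have "approached_table (\<lambda>_ _. 0)" using approached_table_columns[of "\<lambda>_. 0"] by simp
  ultimately show ?thesis
    using sup_ratio_powers_eqI[of "\<lambda>_ _. 0" i j i l a b] idx by (simp add: rpow_def)
next
  case False
  then have s: "0 < a + b" using ab by simp
  let ?m = "\<lambda>y. if y = j then 2 * a / (a + b) else if y = l then 2 * b / (a + b) else 0"
  have "j = 1 \<or> j = 2 \<or> j = 3" "l = 1 \<or> l = 2 \<or> l = 3" using idx by auto
  moreover have "2 * a / (a + b) + 2 * b / (a + b) = 2"
  proof -
    have "2 * a / (a + b) + 2 * b / (a + b) = 2 * (a + b) / (a + b)"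
      by (simp only: distrib_left add_divide_distrib)
    also have "\<dots> = 2" using s by (intro nonzero_mult_div_cancel_right) simp
    finally show ?thesis .
  qed
  ultimately have "?m 1 + ?m 2 + ?m 3 \<le> 2" using idx(4) by (elim disjE; simp add: add.commute)
  then have "approached_table (\<lambda>x. ?m)"
    using ab by (intro approached_table_columns) auto
  then have "sup_ratio_powers (i, j) (i, l) a b =
      ereal (rpow (2 * a / (a + b)) a * rpow (2 * b / (a + b)) b)"
    using sup_ratio_powers_eqI[of "\<lambda>x. ?m" i j i l a b] idx ab
      weighted_amgm_bound[OF local_ratio_pos local_ratio_pos local_ratio_add_le_2 ab s]
    by simp
  also have "rpow (2 * a / (a + b)) a * rpow (2 * b / (a + b)) b =
      2 powr (a + b) * (rpow a a * rpow b b / rpow (a + b) (a + b))"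
    using ab s by (simp add: rpow_def powr_mult powr_divide powr_add)
  finally show ?thesis .
qed

text \<open>
  Split off \<open>b\<close> copies of the product: what remains is the power \<open>a - b\<close> of a single ratio, which is
  at most \<open>2\<close>.
\<close>

lemma sup_transposed_le:
  assumes idx: "i \<in> {1..3}" "j \<in> {1..3}" "i \<noteq> j" and ab: "0 \<le> b" "b \<le> a"
  shows "sup_ratio_powers (i, j) (j, i) a b = ereal (2 powr (a - b))"
proof -
  let ?w = "\<lambda>x y. if (x, y) = (i, j) then 2 else if (x, y) = (j, i) then 1 / 2 else (0::real)"
  have target: "rpow (?w i j) a * rpow (?w j i) b = 2 powr (a - b)"
    using idx by (simp add: rpow_eq_powr powr_diff powr_divide)
  have "rpow (local_ratio i j f) a * rpow (local_ratio j i f) b \<le> 2 powr (a - b)"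
    if f: "f \<in> full_support_lorentzian_cubics" for f
  proof -
    let ?x = "local_ratio i j f" and ?y = "local_ratio j i f"
    have pos: "0 < ?x" "0 < ?y" using local_ratio_pos[OF f] idx by auto
    have "rpow ?x a * rpow ?y b = ?x powr (a - b) * (?x * ?y) powr b"
      using pos by (simp add: rpow_eq_powr powr_mult powr_diff)
    also have "\<dots> \<le> 2 powr (a - b) * 1 powr b"
      using pos ab local_ratio_le_2[OF f] transposed_ratio_mult_le_1[OF f] idx
      by (intro mult_mono powr_mono2) auto
    finally show ?thesis by simp
  qed
  then show ?thesis
    using sup_ratio_powers_eqI[OF approached_table_transposed[OF idx], of i j j i a b] idx ab
    unfolding target by simp
qed

lemma sup_transposed:
  assumes idx: "i \<in> {1..3}" "j \<in> {1..3}" "i \<noteq> j" and ab: "0 \<le> a" "0 \<le> b"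
  shows "sup_ratio_powers (i, j) (j, i) a b = ereal (2 powr \<bar>a - b\<bar>)"
proof (cases "b \<le> a")
  case True
  then show ?thesis using sup_transposed_le[OF idx ab(2)] by simp
next
  case False
  then show ?thesis
    using sup_transposed_le[of j i a b] idx ab sup_ratio_powers_commute[of i j j i a b] by simp
qed

text \<open>
  Two positions in the same column are covered by a table with equal rows. Otherwise they lie in
  different rows and columns without being transposed, so their off-diagonal members belong to one
  common cyclic triple.
\<close>

lemma approached_table_other:
  assumes "i \<in> {1..3}" "j \<in> {1..3}" "k \<in> {1..3}" "l \<in> {1..3}"
    and other: "i \<noteq> k" "i \<noteq> j \<Longrightarrow> (k, l) \<noteq> (j, i)"
  obtains w where "approached_table w" "w i j = 2" "w k l = 2"
proof (cases "j = l")
  case True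
  have "approached_table (\<lambda>x y. if y = j then 2 else 0)"
    using assms(2) by (intro approached_table_columns) auto
  then show ?thesis using that True by simp
next
  case False
  let ?w = "\<lambda>x y. if (x, y) = (i, j) \<or> (x, y) = (k, l) then 2 else (0::real)"
  have "i = 1 \<or> i = 2 \<or> i = 3" "j = 1 \<or> j = 2 \<or> j = 3"
    "k = 1 \<or> k = 2 \<or> k = 3" "l = 1 \<or> l = 2 \<or> l = 3" using assms by auto
  then have "(\<forall>x\<in>{1..3}. ?w x 1 + ?w x 2 + ?w x 3 \<le> 2) \<and>
    (?w 1 3 = 0 \<and> ?w 2 1 = 0 \<and> ?w 3 2 = 0 \<or> ?w 1 2 = 0 \<and> ?w 2 3 = 0 \<and> ?w 3 1 = 0)"
    using False other unfolding ball_index_iff by (elim disjE; simp)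
  then have "approached_table ?w" by (intro approached_table_oriented) auto
  then show ?thesis using that by simp
qed

lemma sup_other:
  assumes idx: "i \<in> {1..3}" "j \<in> {1..3}" "k \<in> {1..3}" "l \<in> {1..3}" and ab: "0 \<le> a" "0 \<le> b"
    and other: "i \<noteq> k" "i \<noteq> j \<Longrightarrow> (k, l) \<noteq> (j, i)"
  shows "sup_ratio_powers (i, j) (k, l) a b = ereal (2 powr (a + b))"
proof -
  obtain w where w: "approached_table w" "w i j = 2" "w k l = 2"
    by (rule approached_table_other[OF idx other])
  have "rpow (local_ratio i j f) a * rpow (local_ratio k l f) b \<le> rpow 2 a * rpow 2 b"
    if f: "f \<in> full_support_lorentzian_cubics" for f
    using local_ratio_le_2[OF f] local_ratio_pos[OF f] idx ab
    by (intro mult_mono rpow_mono rpow_nonneg) (auto intro: less_imp_le)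
  then show ?thesis
    using sup_ratio_powers_eqI[OF w(1), of i j k l a b] w idx ab
    by (simp add: rpow_eq_powr powr_add)
qed

theorem theorem6p3:
  fixes i j k l :: nat and a b :: real
  assumes "(i, j) \<in> {1..3} \<times> {1..3}" and "(k, l) \<in> {1..3} \<times> {1..3}"
    and "(i, j) \<noteq> (k, l)"
    and "0 \<le> a" and "0 \<le> b"
  shows "exactly_one (same_row (i, j) (k, l)) (transposed_off_diagonal (i, j) (k, l))
           (other_pair (i, j) (k, l)) \<and>
         (same_row (i, j) (k, l) \<longrightarrow>
           sup_ratio_powers (i, j) (k, l) a b =
             ereal (2 powr (a + b) * (rpow a a * rpow b b / rpow (a + b) (a + b)))) \<and>
         (transposed_off_diagonal (i, j) (k, l) \<longrightarrow>
           sup_ratio_powers (i, j) (k, l) a b = ereal (2 powr \<bar>a - b\<bar>)) \<and>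
         (other_pair (i, j) (k, l) \<longrightarrow>
           sup_ratio_powers (i, j) (k, l) a b = ereal (2 powr (a + b)))"
proof (intro conjI impI)
  have idx: "i \<in> {1..3}" "j \<in> {1..3}" "k \<in> {1..3}" "l \<in> {1..3}" using assms(1,2) by auto
  show "exactly_one (same_row (i, j) (k, l)) (transposed_off_diagonal (i, j) (k, l))
      (other_pair (i, j) (k, l))"
    by (auto simp: exactly_one_def same_row_def transposed_off_diagonal_def other_pair_def)
  show "sup_ratio_powers (i, j) (k, l) a b =
      ereal (2 powr (a + b) * (rpow a a * rpow b b / rpow (a + b) (a + b)))"
    if "same_row (i, j) (k, l)"
    using that assms(3-5) idx sup_same_row by (simp add: same_row_def)
  show "sup_ratio_powers (i, j) (k, l) a b = ereal (2 powr \<bar>a - b\<bar>)"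
    if "transposed_off_diagonal (i, j) (k, l)"
    using that assms(4,5) idx sup_transposed by (simp add: transposed_off_diagonal_def)
  show "sup_ratio_powers (i, j) (k, l) a b = ereal (2 powr (a + b))"
    if "other_pair (i, j) (k, l)"
    using that
    by (intro sup_other idx assms(4,5))
      (auto simp: other_pair_def same_row_def transposed_off_diagonal_def)
qed

end
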